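(* Let $f:\mathbb{R}^n\to\mathbb{R}$ be $m$-strongly convex with $L$-Lipschitz gradient, let $x\in\mathbb{R}^n$, let $d$ be a descent direction at $x$ (i.e. $d^T\nabla f(x)<0$), let $T>0$ and $\beta\in(0,1)$. Let $t$ be the step size returned by Approximately Exact Line Search $\mathrm{AELS}(f,x,T,\beta,d)$ (defined in the context), and let $t_*=\operatorname{argmin}_{s}f(x+sd)$ be the exact line search step size from the same iterate $x$ along the same direction $d$. Then $$t\in[\beta^2t_*,\,t_*].$$
   Context: $f$ is $m$-strongly convex ($m>0$): $f(y)\ge f(x)+\nabla f(x)^T(y-x)+\frac m2\|y-x\|^2$ for all $x,y$. $f$ has $L$-Lipschitz gradient: $\|\nabla f(x)-\nabla f(y)\|\le L\|x-y\|$ for all $x,y$. Approximately Exact Line Search $\mathrm{AELS}(f,x,T,\beta,d)$: 1. Set $t\leftarrow T$, $f_{old}\leftarrow f(x)$, $f_{new}\leftarrow f(x+td)$, $\alpha\leftarrow\beta$. If $f_{new}\le f_{old}$, set $\alpha\leftarrow\beta^{-1}$. 2. Repeat $\{t\leftarrow\alpha t;\ f_{old}\leftarrow f_{new};\ f_{new}\leftarrow f(x+td)\}$ until $f_{new}\ge f_{old}$. 3. If $t=T/\beta$: set $t\leftarrow T$, $\alpha\leftarrow\beta$, swap the values of $f_{new}$ and $f_{old}$, and then repeat $\{t\leftarrow\alpha t;\ f_{old}\leftarrow f_{new};\ f_{new}\leftarrow f(x+td)\}$ until $f_{new}>f_{old}$. 4. If $\alpha<1$ return $t$; otherwise return $\beta^2t$.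 *)

theory Defs
  imports "HOL-Analysis.Analysis" "HOL-Library.While_Combinator" "HOL-Library.Monad_Syntax"
begin

text \<open>First-order strong convexity; \<open>g\<close> is meant to be the gradient of \<open>f\<close>, which
  the user of this definition has to assume separately.\<close>

definition strongly_convex :: "real \<Rightarrow> ('a::real_inner \<Rightarrow> real) \<Rightarrow> ('a \<Rightarrow> 'a) \<Rightarrow> bool" where
  "strongly_convex m f g \<longleftrightarrow>
     m > 0 \<and> (\<forall>x y. f y \<ge> f x + g x \<bullet> (y - x) + m / 2 * (norm (y - x))\<^sup>2)"

text \<open>The body is executed at least once; the result is \<open>None\<close> iff the loop diverges.\<close>

definition repeat_until :: "('s \<Rightarrow> 's) \<Rightarrow> ('s \<Rightarrow> bool) \<Rightarrow> 's \<Rightarrow> 's option" where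
  "repeat_until body stop s = while_option (\<lambda>s. \<not> stop s) body (body s)"

text \<open>Loop states are triples \<open>(t, f_old, f_new)\<close>.\<close>

definition aels_step ::
  "('a::real_vector \<Rightarrow> real) \<Rightarrow> 'a \<Rightarrow> 'a \<Rightarrow> real \<Rightarrow> real \<times> real \<times> real \<Rightarrow> real \<times> real \<times> real" where
  "aels_step f x d \<alpha> = (\<lambda>(t, f_old, f_new). (\<alpha> * t, f_new, f (x + (\<alpha> * t) *\<^sub>R d)))"

definition AELS ::
  "('a::real_vector \<Rightarrow> real) \<Rightarrow> 'a \<Rightarrow> real \<Rightarrow> real \<Rightarrow> 'a \<Rightarrow> real option" where
  "AELS f x T \<beta> d = do {
     let f_old = f x;
     let f_new = f (x + T *\<^sub>R d);
     let \<alpha> = (if f_new \<le> f_old then inverse \<beta> else \<beta>);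
     (t, f_old, f_new) \<leftarrow>
       repeat_until (aels_step f x d \<alpha>) (\<lambda>(t, f_old, f_new). f_new \<ge> f_old) (T, f_old, f_new);
     (t, \<alpha>) \<leftarrow>
       (if t = T / \<beta> then do {
          (t, f_old, f_new) \<leftarrow>
            repeat_until (aels_step f x d \<beta>) (\<lambda>(t, f_old, f_new). f_new > f_old) (T, f_new, f_old);
          Some (t, \<beta>)
        } else Some (t, \<alpha>));
     Some (if \<alpha> < 1 then t else \<beta>\<^sup>2 * t)
   }"

end

theory Submission imports Defs begin

text \<open>Along the search line, \<open>\<phi> s = f (x + s *\<^sub>R d)\<close> is strictly decreasing up to its minimiser
  \<open>t_star > 0\<close> and strictly increasing afterwards. Comparing \<open>\<phi>\<close> at two consecutive trial steps thus
  tells on which side of \<open>t_star\<close> one of them lies: the last comparison of a loop bounds \<open>t_star\<close> from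
  one side, and the comparison before it (possibly made before the loop) bounds it from the other
  side, two factors of \<open>\<beta>\<close> apart.\<close>

section \<open>Strongly convex functions of one variable\<close>

locale strongly_convex_line =
  fixes \<phi> p :: "real \<Rightarrow> real" and c :: real
  assumes c_pos: "c > 0"
    and lower: "\<phi> s \<ge> \<phi> r + p r * (s - r) + c * (s - r)\<^sup>2"
begin

text \<open>In the bound at 0 the quadratic term beats the linear one for
  \<open>\<bar>s\<bar> > \<bar>p 0\<bar> / c\<close>, so a minimum over that compact interval is
  global.\<close>

lemma minimiser_exists:
  assumes "continuous_on UNIV \<phi>"
  obtains \<mu> where "\<And>s. \<phi> \<mu> \<le> \<phi> s"
proof -
  define R where "R = \<bar>p 0\<bar> / c"
  have R: "R \<ge> 0" using c_pos by (simp add: R_def)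
  obtain \<mu> where \<mu>: "\<mu> \<in> {-R..R}" "\<And>s. s \<in> {-R..R} \<Longrightarrow> \<phi> \<mu> \<le> \<phi> s"
    using continuous_attains_inf[of "{-R..R}" \<phi>] R continuous_on_subset[OF assms] by auto
  have "\<phi> \<mu> \<le> \<phi> s" for s
  proof (cases "s \<in> {-R..R}")
    case False
    then have "R < \<bar>s\<bar>" by auto
    then have "\<bar>p 0\<bar> \<le> c * \<bar>s\<bar>"
      using c_pos by (simp add: R_def pos_divide_less_eq mult.commute)
    then have "\<bar>p 0\<bar> * \<bar>s\<bar> \<le> c * \<bar>s\<bar> * \<bar>s\<bar>"
      by (rule mult_right_mono) simp
    then have "\<bar>p 0 * s\<bar> \<le> c * s\<^sup>2"
      by (simp add: abs_mult power2_eq_square mult.assoc)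
    then have "\<phi> 0 \<le> \<phi> s" using lower[of 0 s] by simp
    with \<mu>(2)[of 0] R show ?thesis by simp
  qed (use \<mu> in blast)
  then show thesis by (rule that)
qed

text \<open>In the bounds from the midpoint \<open>q\<close> towards \<open>s\<close> and
  \<open>\<mu>\<close> the linear terms cancel, so \<open>\<phi> s + \<phi> \<mu>\<close> exceeds
  \<open>2 * \<phi> q\<close>, which is at least \<open>2 * \<phi> \<mu>\<close>.\<close>

lemma minimiser_strict:
  assumes min: "\<And>s. \<phi> \<mu> \<le> \<phi> s" and "s \<noteq> \<mu>"
  shows "\<phi> \<mu> < \<phi> s"
proof -
  define q where "q = (\<mu> + s) / 2"
  have "s - q = - (\<mu> - q)" by (simp add: q_def field_simps)
  then have eq: "p q * (s - q) = - (p q * (\<mu> - q))" by (metis mult_minus_right)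
  have "c * (s - q)\<^sup>2 > 0" "c * (\<mu> - q)\<^sup>2 > 0"
    using c_pos assms(2) by (auto simp: q_def field_simps)
  with lower[of q s] lower[of q \<mu>] min[of q] eq show ?thesis by linarith
qed

text \<open>Minimality of \<open>\<mu>\<close> forces \<open>p a\<close> to have the sign of
  \<open>a - \<mu>\<close>. The product condition puts \<open>b\<close> beyond \<open>a\<close> as
  seen from \<open>\<mu>\<close>, on either side, so the slope at \<open>a\<close> points upwards to
  \<open>b\<close>.\<close>

lemma minimiser_between:
  assumes min: "\<And>s. \<phi> \<mu> \<le> \<phi> s" and side: "(a - \<mu>) * (b - a) > 0"
  shows "\<phi> a < \<phi> b"
proof -
  have ne: "a \<noteq> \<mu>" "b \<noteq> a" using side by auto
  then have "c * (\<mu> - a)\<^sup>2 > 0" "c * (b - a)\<^sup>2 > 0" using c_pos by auto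
  with lower[of a \<mu>] min[of a] have "p a * (a - \<mu>) > 0" by (simp add: algebra_simps)
  with side have "p a * (b - a) > 0"
    by (auto simp: zero_less_mult_iff)
  with lower[of a b] \<open>c * (b - a)\<^sup>2 > 0\<close> show ?thesis by linarith
qed

lemma minimiser_strict_mono_on:
  assumes min: "\<And>s. \<phi> \<mu> \<le> \<phi> s"
  shows "strict_mono_on {\<mu>..} \<phi>"
proof (rule strict_mono_onI)
  fix a b assume "a \<in> {\<mu>..}" "b \<in> {\<mu>..}" "a < b"
  \<comment> \<open>At \<open>a = \<mu>\<close> the product in \<open>minimiser_between\<close>
    vanishes, and \<open>minimiser_strict\<close> takes over.\<close>
  then show "\<phi> a < \<phi> b"
    using minimiser_strict[OF min, of b] minimiser_between[OF min, of a b] by (cases "a = \<mu>") auto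
qed

lemma minimiser_strict_antimono_on:
  assumes min: "\<And>s. \<phi> \<mu> \<le> \<phi> s"
  shows "strict_antimono_on {..\<mu>} \<phi>"
proof (rule monotone_onI)
  fix a b assume "a \<in> {..\<mu>}" "b \<in> {..\<mu>}" "a < b"
  then show "\<phi> a > \<phi> b"
    using minimiser_strict[OF min, of a] minimiser_between[OF min, of b a]
    by (cases "b = \<mu>") (auto simp: mult_neg_neg)
qed

end

section \<open>The loops as geometric sequences of trial steps\<close>

text \<open>The parameter \<open>stop\<close> covers both the weak and the strict exit test. The
  failed tests are recorded because the last of them gives the second bound on the minimiser;
  \<open>a\<close> is arbitrary, being overwritten before the first test.\<close>

lemma repeat_until_aels_step:
  fixes f :: "'a::real_vector \<Rightarrow> real" and x d :: 'a
  defines "\<phi> \<equiv> \<lambda>s. f (x + s *\<^sub>R d)"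
  assumes "\<exists>n. stop (\<phi> (\<alpha> ^ n * t)) (\<phi> (\<alpha> ^ Suc n * t))"
  obtains n where
    "repeat_until (aels_step f x d \<alpha>) (\<lambda>(t, f_old, f_new). stop f_old f_new) (t, a, \<phi> t) =
       Some (\<alpha> ^ Suc n * t, \<phi> (\<alpha> ^ n * t), \<phi> (\<alpha> ^ Suc n * t))"
    "stop (\<phi> (\<alpha> ^ n * t)) (\<phi> (\<alpha> ^ Suc n * t))"
    "\<And>j. j < n \<Longrightarrow> \<not> stop (\<phi> (\<alpha> ^ j * t)) (\<phi> (\<alpha> ^ Suc j * t))"
proof -
  let ?stop = "\<lambda>n. stop (\<phi> (\<alpha> ^ n * t)) (\<phi> (\<alpha> ^ Suc n * t))"
  \<comment> \<open>The inner \<open>aels_step\<close> is the unconditional first run of the body,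
    hence \<open>Suc k\<close>.\<close>
  have iter: "(aels_step f x d \<alpha> ^^ k) (aels_step f x d \<alpha> (t, a, \<phi> t)) =
      (\<alpha> ^ Suc k * t, \<phi> (\<alpha> ^ k * t), \<phi> (\<alpha> ^ Suc k * t))" for k
    by (induction k) (auto simp: aels_step_def \<phi>_def mult.assoc)
  define n where "n = (LEAST n. ?stop n)"
  show thesis
  proof (rule that[of n])
    show "?stop n" unfolding n_def by (rule LeastI_ex) fact
    show "\<not> ?stop j" if "j < n" for j using that not_less_Least unfolding n_def by blast
    show "repeat_until (aels_step f x d \<alpha>) (\<lambda>(t, f_old, f_new). stop f_old f_new) (t, a, \<phi> t) =
       Some (\<alpha> ^ Suc n * t, \<phi> (\<alpha> ^ n * t), \<phi> (\<alpha> ^ Suc n * t))"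
      unfolding repeat_until_def while_option_def iter using assms(2) by (simp add: n_def iter)
  qed
qed

section \<open>The line search on a unimodal function\<close>

lemma AELS_bounds_unimodal:
  fixes f :: "'a::real_vector \<Rightarrow> real" and x d :: 'a
  defines "\<phi> \<equiv> \<lambda>s. f (x + s *\<^sub>R d)"
  assumes anti: "strict_antimono_on {..\<mu>} \<phi>"
    and mono: "strict_mono_on {\<mu>..} \<phi>"
    and \<mu>: "\<mu> > 0" and T: "T > 0" and \<beta>: "0 < \<beta>" "\<beta> < 1"
  shows "\<exists>t. AELS f x T \<beta> d = Some t \<and> t \<in> {\<beta>\<^sup>2 * \<mu>..\<mu>}"
proof -
  \<comment> \<open>Contrapositives of the two monotonicity assumptions: each turns a comparison of
    values into a bound on \<open>\<mu>\<close>.\<close>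
  have left: "a \<le> \<mu>" if "a < b" "\<phi> a \<ge> \<phi> b" for a b
    using that strict_mono_onD[OF mono, of a b] by (cases "a \<le> \<mu>") auto
  have right: "\<mu> \<le> b" if "a < b" "\<phi> a \<le> \<phi> b" for a b
    using that monotone_onD[OF anti, of a b] by (cases "\<mu> \<le> b") auto
  have shrink: "\<beta> * s < s" if "s > 0" for s using that \<beta> by simp
  have pos: "\<beta> ^ n * T > 0" "inverse \<beta> ^ n * T > 0" for n using \<beta> T by auto

  \<comment> \<open>Termination of the backward loops: the steps tend to 0, hence drop below
    \<open>\<mu> > 0\<close>, where shrinking further increases \<open>\<phi>\<close>.\<close>
  have "(\<lambda>n. \<beta> ^ n * T) \<longlonglongrightarrow> 0 * T"
    using \<beta> by (intro tendsto_mult LIMSEQ_power_zero tendsto_const) auto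
  then have "\<forall>\<^sub>F n in sequentially. \<beta> ^ n * T < \<mu>"
    using \<mu> by (auto dest: order_tendstoD)
  then obtain n where n: "\<beta> ^ n * T < \<mu>" using eventually_happens by fastforce
  have back_gt: "\<exists>n. \<phi> (\<beta> ^ n * T) < \<phi> (\<beta> ^ Suc n * T)"
    using n shrink[OF pos(1)[of n]] monotone_onD[OF anti, of "\<beta> ^ Suc n * T" "\<beta> ^ n * T"]
    by (auto intro!: exI[of _ n] simp: mult.assoc)
  then have back_ge: "\<exists>n. \<phi> (\<beta> ^ n * T) \<le> \<phi> (\<beta> ^ Suc n * T)"
    using less_imp_le by blast
  \<comment> \<open>Termination of the forward loop: the steps eventually pass \<open>\<mu>\<close>,
    where growing further increases \<open>\<phi>\<close>.\<close>
  have "inverse \<beta> > 1" using \<beta> by (simp add: one_less_inverse)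
  then obtain k where "inverse \<beta> ^ k > \<mu> / T" using real_arch_pow by blast
  then have k: "inverse \<beta> ^ k * T > \<mu>" using T by (simp add: pos_divide_less_eq)
  have grow: "s < inverse \<beta> * s" if "s > 0" for s using that \<open>inverse \<beta> > 1\<close> by simp
  have fwd: "\<exists>n. \<phi> (inverse \<beta> ^ n * T) \<le> \<phi> (inverse \<beta> ^ Suc n * T)"
    using k grow[OF pos(2)[of k]]
      strict_mono_onD[OF mono, of "inverse \<beta> ^ k * T" "inverse \<beta> ^ Suc k * T"]
    by (auto intro!: exI[of _ k] simp: mult.assoc)

  \<comment> \<open>Shared by both backward loops, so the comparisons are weak. For
    \<open>n = 0\<close> there is no earlier comparison inside the loop, and \<open>init\<close>
    supplies the lower bound instead.\<close>
  have in_range: "\<beta> ^ Suc n * T \<in> {\<beta>\<^sup>2 * \<mu>..\<mu>}"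
    if last: "\<phi> (\<beta> ^ n * T) \<le> \<phi> (\<beta> ^ Suc n * T)"
      and prev: "\<And>j. j < n \<Longrightarrow> \<phi> (\<beta> ^ Suc j * T) \<le> \<phi> (\<beta> ^ j * T)"
      and init: "\<mu> \<le> T / \<beta>" for n
  proof -
    have "\<beta> ^ Suc n * T \<le> \<mu>"
      using left[OF _ last] shrink[OF pos(1)[of n]] by (simp add: mult.assoc)
    moreover have "\<beta>\<^sup>2 * \<mu> \<le> \<beta> ^ Suc n * T"
    proof (cases n)
      case 0
      have "\<beta>\<^sup>2 * \<mu> \<le> \<beta>\<^sup>2 * (T / \<beta>)" using init by (intro mult_left_mono) auto
      then show ?thesis using 0 \<beta> by (simp add: power2_eq_square)
    next
      case (Suc j)
      have "\<mu> \<le> \<beta> ^ j * T"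
        using right[OF _ prev[of j]] shrink[OF pos(1)[of j]] Suc by (simp add: mult.assoc)
      then have "\<beta>\<^sup>2 * \<mu> \<le> \<beta>\<^sup>2 * (\<beta> ^ j * T)" by (intro mult_left_mono) auto
      then show ?thesis using Suc by (simp add: power2_eq_square mult.assoc)
    qed
    ultimately show ?thesis by simp
  qed

  show ?thesis
  proof (cases "\<phi> T \<le> f x")
    case False
    then have "\<mu> \<le> T" using right[of 0 T] T by (simp add: \<phi>_def)
    also have "T \<le> T / \<beta>" using \<beta> T by (simp add: field_simps)
    finally have init: "\<mu> \<le> T / \<beta>" .
    obtain n where n:
      "repeat_until (aels_step f x d \<beta>) (\<lambda>(t, f_old, f_new). f_new \<ge> f_old) (T, f x, \<phi> T) =
         Some (\<beta> ^ Suc n * T, \<phi> (\<beta> ^ n * T), \<phi> (\<beta> ^ Suc n * T))"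
      "\<phi> (\<beta> ^ n * T) \<le> \<phi> (\<beta> ^ Suc n * T)"
      "\<And>j. j < n \<Longrightarrow> \<not> \<phi> (\<beta> ^ j * T) \<le> \<phi> (\<beta> ^ Suc j * T)"
      using back_ge repeat_until_aels_step[where stop = "\<lambda>a b. a \<le> b" and \<alpha> = "\<beta>"
            and f = f and x = x and d = d and t = T and a = "f x"]
      unfolding \<phi>_def by blast
    \<comment> \<open>A backward search stays below \<open>T\<close>, so the restart test
      \<open>t = T / \<beta>\<close> fails.\<close>
    have "\<beta> ^ Suc n * T < 1 * T"
      using \<beta> T by (intro mult_strict_right_mono power_Suc_less_one)
    then have "\<beta> ^ Suc n * T \<noteq> T / \<beta>" using \<open>T \<le> T / \<beta>\<close> by auto
    then have "AELS f x T \<beta> d = Some (\<beta> ^ Suc n * T)"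
      using n(1) False \<beta> by (simp add: AELS_def Let_def \<phi>_def)
    with in_range[OF n(2) _ init] n(3) show ?thesis by (metis linear)
  next
    case True
    obtain n where n:
      "repeat_until (aels_step f x d (inverse \<beta>)) (\<lambda>(t, f_old, f_new). f_new \<ge> f_old) (T, f x, \<phi> T) =
         Some (inverse \<beta> ^ Suc n * T, \<phi> (inverse \<beta> ^ n * T), \<phi> (inverse \<beta> ^ Suc n * T))"
      "\<phi> (inverse \<beta> ^ n * T) \<le> \<phi> (inverse \<beta> ^ Suc n * T)"
      "\<And>j. j < n \<Longrightarrow> \<not> \<phi> (inverse \<beta> ^ j * T) \<le> \<phi> (inverse \<beta> ^ Suc j * T)"
      using fwd repeat_until_aels_step[where stop = "\<lambda>a b. a \<le> b" and \<alpha> = "inverse \<beta>"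
            and f = f and x = x and d = d and t = T and a = "f x"]
      unfolding \<phi>_def by blast
    have upper: "\<mu> \<le> inverse \<beta> ^ Suc n * T"
      using right[OF _ n(2)] grow[OF pos(2)[of n]] by (simp add: mult.assoc)
    show ?thesis
    proof (cases n)
      \<comment> \<open>The forward loop stopped at its first step \<open>T / \<beta>\<close>, which
        triggers the backward restart from \<open>T\<close>; \<open>upper\<close> is then exactly
        the \<open>init\<close> of \<open>in_range\<close>.\<close>
      case 0
      obtain k where k:
        "repeat_until (aels_step f x d \<beta>) (\<lambda>(t, f_old, f_new). f_new > f_old)
           (T, \<phi> (inverse \<beta> * T), \<phi> T) =
           Some (\<beta> ^ Suc k * T, \<phi> (\<beta> ^ k * T), \<phi> (\<beta> ^ Suc k * T))"
        "\<phi> (\<beta> ^ k * T) < \<phi> (\<beta> ^ Suc k * T)"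
        "\<And>j. j < k \<Longrightarrow> \<not> \<phi> (\<beta> ^ j * T) < \<phi> (\<beta> ^ Suc j * T)"
        using back_gt repeat_until_aels_step[where stop = "\<lambda>a b. a < b" and \<alpha> = "\<beta>"
            and f = f and x = x and d = d and t = T and a = "\<phi> (inverse \<beta> * T)"]
        unfolding \<phi>_def by blast
      have "inverse \<beta> * T = T / \<beta>" by (simp add: field_simps)
      then have "AELS f x T \<beta> d = Some (\<beta> ^ Suc k * T)"
        using n(1) k(1) 0 True \<beta> by (simp add: AELS_def Let_def \<phi>_def)
      moreover have "\<mu> \<le> T / \<beta>" using upper 0 by (simp add: field_simps)
      ultimately show ?thesis
        using in_range[of k] k(2,3) by (metis less_imp_le not_less)
    next
      \<comment> \<open>At least two growths took place, so there is no restart. The factor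
        \<open>\<beta>\<^sup>2\<close> undoes two of them, returning the left end of the last pair
        at which \<open>\<phi>\<close> still decreased.\<close>
      case (Suc j)
      have "inverse \<beta> ^ 1 < inverse \<beta> ^ Suc n"
        using Suc \<open>inverse \<beta> > 1\<close> by (intro power_strict_increasing) auto
      then have "inverse \<beta> ^ 1 * T < inverse \<beta> ^ Suc n * T"
        using T by (rule mult_strict_right_mono)
      moreover have "inverse \<beta> ^ 1 * T = T / \<beta>" by (simp add: field_simps)
      ultimately have ne: "inverse \<beta> ^ Suc n * T \<noteq> T / \<beta>" by linarith
      have res: "\<beta>\<^sup>2 * (inverse \<beta> ^ Suc n * T) = inverse \<beta> ^ j * T"
        using Suc \<beta> by (simp add: power2_eq_square field_simps)
      have "AELS f x T \<beta> d = Some (\<beta>\<^sup>2 * (inverse \<beta> ^ Suc n * T))"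
        using n(1) ne True \<open>inverse \<beta> > 1\<close> by (simp add: AELS_def Let_def \<phi>_def)
      moreover have "\<beta>\<^sup>2 * \<mu> \<le> \<beta>\<^sup>2 * (inverse \<beta> ^ Suc n * T)"
        using upper by (intro mult_left_mono) auto
      moreover have "inverse \<beta> ^ j * T \<le> \<mu>"
        using left[of "inverse \<beta> ^ j * T" "inverse \<beta> ^ Suc j * T"] n(3)[of j] Suc grow[OF pos(2)[of j]]
        by (simp add: mult.assoc)
      ultimately show ?thesis unfolding res by simp
    qed
  qed
qed

section \<open>Restriction of \<open>f\<close> to the search line\<close>

theorem mainTheorem3:
  fixes f :: "real ^ 'n \<Rightarrow> real"
    and grad_f :: "real ^ 'n \<Rightarrow> real ^ 'n"
    and x d :: "real ^ 'n"
    and m L T \<beta> t_star :: real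
  assumes "\<And>y. GDERIV f y :> grad_f y"
    and "strongly_convex m f grad_f"
    and "L-lipschitz_on UNIV grad_f"
    and "d \<bullet> grad_f x < 0"
    and "T > 0"
    and "0 < \<beta>" and "\<beta> < 1"
    and "t_star = arg_min (\<lambda>s. f (x + s *\<^sub>R d)) (\<lambda>s. True)"
  shows "\<exists>t. AELS f x T \<beta> d = Some t \<and> t \<in> {\<beta>\<^sup>2 * t_star..t_star}"
proof -
  define \<phi> where "\<phi> s = f (x + s *\<^sub>R d)" for s
  define p where "p s = grad_f (x + s *\<^sub>R d) \<bullet> d" for s
  have sc: "m > 0" "f z \<ge> f y + grad_f y \<bullet> (z - y) + m / 2 * (norm (z - y))\<^sup>2" for y z
    using assms(2) by (auto simp: strongly_convex_def)
  have "d \<noteq> 0" using assms(4) by auto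
  \<comment> \<open>Points on the line differ by \<open>(s - r) *\<^sub>R d\<close>, so the squared
    norm contributes the factor \<open>(norm d)\<^sup>2\<close> to the constant.\<close>
  interpret strongly_convex_line \<phi> p "m / 2 * (norm d)\<^sup>2"
  proof
    show "m / 2 * (norm d)\<^sup>2 > 0" using sc(1) \<open>d \<noteq> 0\<close> by simp
    fix s r
    have "x + s *\<^sub>R d - (x + r *\<^sub>R d) = (s - r) *\<^sub>R d" by (simp add: algebra_simps)
    then show "\<phi> s \<ge> \<phi> r + p r * (s - r) + m / 2 * (norm d)\<^sup>2 * (s - r)\<^sup>2"
      using sc(2)[of "x + r *\<^sub>R d" "x + s *\<^sub>R d"]
      by (simp add: \<phi>_def p_def power_mult_distrib mult_ac)
  qed
  have deriv: "(\<phi> has_real_derivative p s) (at s)" for s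
  proof -
    have "(f has_derivative (\<lambda>h. h \<bullet> grad_f (x + s *\<^sub>R d))) (at (x + s *\<^sub>R d))"
      using assms(1) by (simp add: gderiv_def)
    moreover have "((\<lambda>s. x + s *\<^sub>R d) has_derivative (\<lambda>h. h *\<^sub>R d)) (at s)"
      by (auto intro!: derivative_eq_intros)
    ultimately show ?thesis
      using has_derivative_compose[of "\<lambda>s. x + s *\<^sub>R d" _ s UNIV f]
      by (fastforce simp: has_field_derivative_def \<phi>_def[abs_def] p_def inner_commute
          mult.commute[of _ "_ \<bullet> _"])
  qed
  then have "continuous_on UNIV \<phi>"
    by (intro continuous_at_imp_continuous_on ballI) (rule DERIV_isCont)
  then obtain \<mu> where "\<And>s. \<phi> \<mu> \<le> \<phi> s" using minimiser_exists by blast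
  \<comment> \<open>\<open>arg_min\<close> is a Hilbert choice: \<open>t_star\<close> is known to be
    a minimiser only once one exists.\<close>
  then have "\<exists>s. is_arg_min \<phi> (\<lambda>s. True) s" by (auto simp: is_arg_min_linorder)
  then have "is_arg_min \<phi> (\<lambda>s. True) (arg_min \<phi> (\<lambda>s. True))"
    unfolding arg_min_def by (rule someI_ex)
  moreover have "t_star = arg_min \<phi> (\<lambda>s. True)"
    using assms(8) by (simp add: \<phi>_def[abs_def])
  ultimately have "is_arg_min \<phi> (\<lambda>s. True) t_star" by simp
  then have min: "\<phi> t_star \<le> \<phi> s" for s by (simp add: is_arg_min_linorder)
  have "p 0 < 0" using assms(4) by (simp add: p_def inner_commute)
  \<comment> \<open>The negative slope at 0 gives some \<open>e > 0\<close> with a smaller value,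
    whereas \<open>t_star \<le> 0\<close> would make \<open>\<phi>\<close> increase from 0 to
    \<open>e\<close>.\<close>
  have "t_star > 0"
  proof (rule ccontr)
    assume "\<not> t_star > 0"
    obtain e where "e > 0" "\<phi> e < \<phi> 0"
      using DERIV_neg_dec_right[OF deriv \<open>p 0 < 0\<close>] by (metis add_0 dense)
    with strict_mono_onD[OF minimiser_strict_mono_on[OF min], of 0 e] \<open>\<not> t_star > 0\<close>
    show False by simp
  qed
  with minimiser_strict_antimono_on[OF min] minimiser_strict_mono_on[OF min] assms(5-7)
  show ?thesis unfolding \<phi>_def[abs_def] by (intro AELS_bounds_unimodal)
qed

end
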